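(* Let $t\ge 2$ and let $G=K_{m_1,m_2,\ldots,m_t}$ be a complete $t$-partite graph with part sizes satisfying $m_1=m_2=\cdots=m_i<m_{i+1}\le\cdots\le m_t$ (so $i$ is the number of parts of minimum size), and let $n=\sum_{j=1}^t m_j$. Then $$ b_{\rm R}(G)=\begin{cases} \lceil i/2\rceil & \text{if } m_i=1 \text{ and } n\ge 3;\\ 2 & \text{if } m_i=2 \text{ and } i=1;\\ i & \text{if } m_i=2 \text{ and } i\ge 2;\\ n-1 & \text{if } m_i=3 \text{ and } i=t\ge 3;\\ n-m_t & \text{if } m_i\ge 3 \text{ and } m_t\ge 4. \end{cases} $$
   Context: All graphs are finite, simple and undirected. A Roman dominating function on a graph $G=(V,E)$ is a function $f:V\to\{0,1,2\}$ such that every vertex $u$ with $f(u)=0$ is adjacent to at least one vertex $v$ with $f(v)=2$; its weight is $\sum_{u\in V}f(u)$. The Roman domination number $\gamma_{\rm R}(G)$ is the minimum weight of a Roman dominating function on $G$. The Roman bondage number of a nonempty graph $G$ is $b_{\rm R}(G)=\min\{|B|: B\subseteq E(G),\ \gamma_{\rm R}(G-B)>\gamma_{\rm R}(G)\}$. *)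

theory Defs
  imports Complex_Main "HOL-Library.Extended_Nat" "HOL-Library.Disjoint_Sets"
begin

text \<open>
  A finite simple undirected graph is given by its vertex set \<open>V\<close> and its edge set \<open>E\<close>, a set of
  two-element subsets of \<open>V\<close>.
\<close>

definition simple_graph :: "'a set \<Rightarrow> 'a set set \<Rightarrow> bool" where
  "simple_graph V E \<longleftrightarrow> finite V \<and> (\<forall>e\<in>E. e \<subseteq> V \<and> card e = 2)"

text \<open>Only the values of \<open>f\<close> on \<open>V\<close> matter.\<close>

definition roman_dominating :: "'a set \<Rightarrow> 'a set set \<Rightarrow> ('a \<Rightarrow> nat) \<Rightarrow> bool" where
  "roman_dominating V E f \<longleftrightarrow>
     (\<forall>u\<in>V. f u \<in> {0, 1, 2}) \<and>
     (\<forall>u\<in>V. f u = 0 \<longrightarrow> (\<exists>v\<in>V. {u, v} \<in> E \<and> f v = 2))"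

text \<open>The minimum exists, since the constant function 1 is Roman dominating.\<close>

definition roman_domination_number :: "'a set \<Rightarrow> 'a set set \<Rightarrow> nat" where
  "roman_domination_number V E = (LEAST w. \<exists>f. roman_dominating V E f \<and> w = (\<Sum>u\<in>V. f u))"

text \<open>
  For some graphs (such as \<open>K\<^sub>2\<close>) no edge deletion increases the Roman domination number, and the
  minimum is over the empty set; extended naturals give it the value \<open>\<infinity>\<close>. A finite value is
  therefore always attained by some \<open>B\<close>.
\<close>

definition roman_bondage_number :: "'a set \<Rightarrow> 'a set set \<Rightarrow> enat" where
  "roman_bondage_number V E =
     Inf {enat (card B) | B.
       B \<subseteq> E \<and> roman_domination_number V (E - B) > roman_domination_number V E}"

text \<open>Positive cardinality makes every part finite and nonempty.\<close>

definition complete_multipartite ::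
    "'a set \<Rightarrow> 'a set set \<Rightarrow> nat \<Rightarrow> (nat \<Rightarrow> nat) \<Rightarrow> bool" where
  "complete_multipartite V E t m \<longleftrightarrow>
     (\<exists>P. disjoint_family_on P {1..t} \<and>
          V = (\<Union>j\<in>{1..t}. P j) \<and>
          (\<forall>j\<in>{1..t}. card (P j) = m j \<and> m j \<ge> 1) \<and>
          E = {{u, v} | u v j k. j \<in> {1..t} \<and> k \<in> {1..t} \<and> j \<noteq> k \<and> u \<in> P j \<and> v \<in> P k})"

end

theory Submission imports Defs begin

text \<open>
  A Roman dominating function of weight at most \<open>k\<close> amounts to a set of vertices of value 2 and a set
  of vertices of value 1. For weights 2 and 3 only one vertex has value 2, so that a set \<open>B\<close> of edges
  raises the Roman domination number iff it covers all vertices of the parts of size 1 (or 2,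
  respectively).

  If all parts have at least 3 vertices, the Roman domination number is 4, and \<open>B\<close> has to destroy
  all dominating pairs of vertices. If \<open>B\<close> misses a vertex \<open>u\<close>, then each vertex outside the part of
  \<open>u\<close> has an edge of \<open>B\<close> into that part. Otherwise either \<open>B\<close> has at least \<open>card V\<close> edges or some
  vertex \<open>u\<close> lies on exactly one edge \<open>{u, w}\<close> of \<open>B\<close>; the pairs \<open>u, v\<close> then force a private edge of
  \<open>B\<close> for every \<open>v\<close> outside the part of \<open>u\<close>, besides \<open>{u, w}\<close>. When all parts have size 3, this
  count is one short of the claim, and the case of equality is excluded by following leaves and
  their neighbours. Isolating a vertex of a largest part (and, for parts of size 3, deleting an edge
  at each of the two other vertices of that part) attains the bounds.
\<close>

section \<open>Roman domination and bondage\<close>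

text \<open>\<open>X\<close> holds the vertices of value 2 and \<open>Y\<close> those of value 1.
  They may overlap and \<open>k\<close> only bounds the weight, so witnesses need no disjointness
  proof.\<close>

definition rdn_le :: "'a set \<Rightarrow> 'a set set \<Rightarrow> nat \<Rightarrow> bool" where
  "rdn_le V E k \<longleftrightarrow> (\<exists>X Y. X \<subseteq> V \<and> Y \<subseteq> V \<and> 2 * card X + card Y \<le> k \<and>
     (\<forall>u\<in>V. u \<in> X \<or> u \<in> Y \<or> (\<exists>v\<in>X. {u, v} \<in> E)))"

lemma rdn_leI:
  assumes "X \<subseteq> V" "Y \<subseteq> V" "2 * card X + card Y \<le> k"
    and "\<And>u. u \<in> V \<Longrightarrow> u \<notin> X \<Longrightarrow> u \<notin> Y \<Longrightarrow> \<exists>v\<in>X. {u, v} \<in> E"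
  shows "rdn_le V E k"
  unfolding rdn_le_def using assms by blast

lemma roman_domination_number_le_iff:
  assumes "finite V"
  shows "roman_domination_number V E \<le> k \<longleftrightarrow> rdn_le V E k"
proof -
  let ?Q = "\<lambda>w. \<exists>f. roman_dominating V E f \<and> w = (\<Sum>u\<in>V. f u)"
  have "?Q (\<Sum>u\<in>V. 1)"
    by (rule exI[of _ "\<lambda>_. 1"]) (simp add: roman_dominating_def)
  then have Q: "?Q (roman_domination_number V E)"
    unfolding roman_domination_number_def by (rule LeastI)
  show ?thesis
  proof
    assume k: "roman_domination_number V E \<le> k"
    obtain f where f: "roman_dominating V E f" "roman_domination_number V E = (\<Sum>u\<in>V. f u)"
      using Q by blast
    define X where "X = {u\<in>V. f u = 2}"
    define Y where "Y = {u\<in>V. f u = 1}"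
    have f012: "f u = 0 \<or> f u = 1 \<or> f u = 2" if "u \<in> V" for u
      using f(1) that by (auto simp: roman_dominating_def)
    have "(\<Sum>u\<in>V. f u) = (\<Sum>u\<in>V. (if f u = 2 then 2 else 0) + (if f u = 1 then 1 else 0))"
      using f012 by (intro sum.cong) fastforce+
    also have "\<dots> = 2 * card X + card Y"
      using assms by (simp add: sum.distrib sum.If_cases X_def Y_def Int_def conj_commute)
    finally have "2 * card X + card Y \<le> k" using f k by simp
    moreover have "\<exists>v\<in>X. {u, v} \<in> E" if "u \<in> V" "u \<notin> X" "u \<notin> Y" for u
      using f(1) f012[of u] that unfolding roman_dominating_def X_def Y_def by auto
    ultimately show "rdn_le V E k"
      by (intro rdn_leI[of X _ Y]) (auto simp: X_def Y_def)
  next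
    assume "rdn_le V E k"
    then obtain X Y where XY: "X \<subseteq> V" "Y \<subseteq> V" "2 * card X + card Y \<le> k"
      "\<And>u. u \<in> V \<Longrightarrow> u \<notin> X \<Longrightarrow> u \<notin> Y \<Longrightarrow> \<exists>v\<in>X. {u, v} \<in> E"
      unfolding rdn_le_def by blast
    \<comment> \<open>On the overlap of \<open>X\<close> and \<open>Y\<close> the value 2 wins, so
      the weight is at most \<open>2 * card X + card Y\<close>.\<close>
    define f where "f u = (if u \<in> X then 2 else if u \<in> Y then 1 else (0::nat))" for u
    have "roman_dominating V E f"
      unfolding roman_dominating_def
    proof (intro conjI ballI impI)
      fix u assume "u \<in> V" "f u = 0"
      then have "u \<notin> X" "u \<notin> Y" by (auto simp: f_def split: if_splits)
      with XY(4)[of u] \<open>u \<in> V\<close> obtain v where "v \<in> X" "{u, v} \<in> E" by blast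
      then show "\<exists>v\<in>V. {u, v} \<in> E \<and> f v = 2" using XY(1) by (auto simp: f_def)
    qed (simp add: f_def)
    then have "roman_domination_number V E \<le> (\<Sum>u\<in>V. f u)"
      unfolding roman_domination_number_def by (intro Least_le) blast
    also have "\<dots> \<le> (\<Sum>u\<in>V. (if u \<in> X then 2 else 0) + (if u \<in> Y then 1 else 0))"
      by (intro sum_mono) (auto simp: f_def)
    also have "\<dots> = 2 * card X + card Y"
      using assms XY(1,2) by (simp add: sum.distrib sum.If_cases Int_absorb1)
    finally show "roman_domination_number V E \<le> k" using XY(3) by linarith
  qed
qed

text \<open>Without a vertex of value 2 every vertex would have value 1, at total weight
  \<open>card V\<close>.\<close>

lemma rdn_leE:
  assumes "rdn_le V E k" "k < card V" "finite V"
  obtains X Y where "X \<subseteq> V" "Y \<subseteq> V" "2 * card X + card Y \<le> k" "1 \<le> card X"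
    "\<And>u. u \<in> V \<Longrightarrow> u \<notin> X \<Longrightarrow> u \<notin> Y \<Longrightarrow> \<exists>v\<in>X. {u, v} \<in> E"
proof -
  obtain X Y where XY: "X \<subseteq> V" "Y \<subseteq> V" "2 * card X + card Y \<le> k"
    "\<And>u. u \<in> V \<Longrightarrow> u \<notin> X \<Longrightarrow> u \<notin> Y \<Longrightarrow> \<exists>v\<in>X. {u, v} \<in> E"
    using assms(1) unfolding rdn_le_def by blast
  have "X \<noteq> {}"
  proof
    assume "X = {}"
    with XY(4) have "V \<subseteq> Y" by auto
    then have "card V \<le> card Y" using XY(2) assms(3) by (meson card_mono finite_subset)
    with XY(3) assms(2) show False by linarith
  qed
  then have "1 \<le> card X" using XY(1) assms(3) by (metis One_nat_def Suc_leI card_gt_0_iff finite_subset)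
  with XY that show thesis by blast
qed

lemma card_le_oneE:
  assumes "finite Y" "card Y \<le> 1"
  obtains a where "Y \<subseteq> {a}"
  using assms by (metis One_nat_def card_le_Suc0_iff_eq empty_subsetI is_singletonI' is_singleton_def
      order_refl)

lemma not_rdn_le_1:
  assumes "finite V" "2 \<le> card V"
  shows "\<not> rdn_le V E 1"
proof
  assume "rdn_le V E 1"
  then show False by (rule rdn_leE) (use assms in auto)
qed

lemma rdn_le_2D:
  assumes "finite V" "3 \<le> card V" "rdn_le V E 2"
  shows "\<exists>v\<in>V. \<forall>u\<in>V. u \<noteq> v \<longrightarrow> {u, v} \<in> E"
proof -
  obtain X Y where XY: "X \<subseteq> V" "Y \<subseteq> V" "2 * card X + card Y \<le> 2" "1 \<le> card X"
    "\<And>u. u \<in> V \<Longrightarrow> u \<notin> X \<Longrightarrow> u \<notin> Y \<Longrightarrow> \<exists>v\<in>X. {u, v} \<in> E"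
    using rdn_leE[OF assms(3) _ assms(1)] assms(2) by auto
  have "card X = 1" "card Y = 0" using XY(3,4) by auto
  then obtain v where "X = {v}" "Y = {}"
    using XY(2) assms(1) by (metis card_0_eq card_1_singletonE finite_subset)
  with XY show ?thesis by auto
qed

lemma rdn_le_3D:
  assumes "finite V" "4 \<le> card V" "rdn_le V E 3"
  shows "\<exists>v\<in>V. \<exists>a. \<forall>u\<in>V. u \<noteq> v \<longrightarrow> u \<noteq> a \<longrightarrow> {u, v} \<in> E"
proof -
  obtain X Y where XY: "X \<subseteq> V" "Y \<subseteq> V" "2 * card X + card Y \<le> 3" "1 \<le> card X"
    "\<And>u. u \<in> V \<Longrightarrow> u \<notin> X \<Longrightarrow> u \<notin> Y \<Longrightarrow> \<exists>v\<in>X. {u, v} \<in> E"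
    using rdn_leE[OF assms(3) _ assms(1)] assms(2) by auto
  have "card X = 1" "card Y \<le> 1" using XY(3,4) by auto
  then obtain v a where "X = {v}" "Y \<subseteq> {a}"
    using XY(2) assms(1) by (metis card_1_singletonE card_le_oneE finite_subset)
  show ?thesis
  proof (intro bexI exI ballI impI)
    show "v \<in> V" using XY(1) \<open>X = {v}\<close> by simp
    fix u assume "u \<in> V" "u \<noteq> v" "u \<noteq> a"
    then show "{u, v} \<in> E" using XY(5)[of u] \<open>X = {v}\<close> \<open>Y \<subseteq> {a}\<close> by auto
  qed
qed

text \<open>The assumptions on \<open>k\<close> fix the Roman domination number as
  \<open>Suc k\<close>. An upper bound on \<open>card B\<^sub>0\<close> suffices, since
  \<open>lower\<close> applies to \<open>B\<^sub>0\<close> too.\<close>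

lemma roman_bondage_number_eqI:
  assumes "simple_graph V E"
    and k: "rdn_le V E (Suc k)" "\<not> rdn_le V E k"
    and upper: "B\<^sub>0 \<subseteq> E" "card B\<^sub>0 \<le> c" "\<not> rdn_le V (E - B\<^sub>0) (Suc k)"
    and lower: "\<And>B. B \<subseteq> E \<Longrightarrow> \<not> rdn_le V (E - B) (Suc k) \<Longrightarrow> c \<le> card B"
  shows "roman_bondage_number V E = enat c"
proof -
  have fin: "finite V" using assms(1) by (simp add: simple_graph_def)
  have r: "roman_domination_number V E = Suc k"
    using k by (simp add: roman_domination_number_le_iff[OF fin, symmetric])
  have gt: "roman_domination_number V F > Suc k \<longleftrightarrow> \<not> rdn_le V F (Suc k)" for F
    by (simp add: roman_domination_number_le_iff[OF fin, symmetric] not_le)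
  have "roman_bondage_number V E \<le> enat (card B\<^sub>0)"
    unfolding roman_bondage_number_def r gt using upper by (intro Inf_lower) blast
  also have "\<dots> \<le> enat c" using upper by simp
  finally have "roman_bondage_number V E \<le> enat c" .
  moreover have "enat c \<le> roman_bondage_number V E"
    unfolding roman_bondage_number_def r gt using lower by (intro Inf_greatest) auto
  ultimately show ?thesis by (rule antisym)
qed

section \<open>Complete multipartite graphs\<close>

text \<open>The parts are the fibres of a labelling \<open>p\<close>, so that lying in the same part
  is an equation. As \<open>edge_iff\<close> speaks of unordered pairs only, \<open>edges\<close>
  rules out other members of \<open>E\<close>.\<close>

locale multipartite =
  fixes V :: "'a set" and E :: "'a set set" and p :: "'a \<Rightarrow> nat"
  assumes finV: "finite V"
    and edge_iff: "\<And>u v. {u, v} \<in> E \<longleftrightarrow> u \<in> V \<and> v \<in> V \<and> p u \<noteq> p v"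
    and edges: "\<And>e. e \<in> E \<Longrightarrow> e \<subseteq> V \<and> card e = 2"
begin

definition part :: "'a \<Rightarrow> 'a set" where
  "part u = {v\<in>V. p v = p u}"

lemma simple: "simple_graph V E"
  using finV edges by (auto simp: simple_graph_def)

lemma finE: "finite E"
  by (rule finite_subset[of _ "Pow V"]) (use edges finV in auto)

lemma finite_part [simp]: "finite (part u)"
  using finV by (simp add: part_def)

lemma card_minus_part: "card (V - part u) = card V - card (part u)"
  using finV by (intro card_Diff_subset) (auto simp: part_def)

lemma part_eq_singleton:
  assumes "u \<in> V" "card (part u) = 1"
  shows "part u = {u}"
proof -
  have "u \<in> part u" using assms(1) by (simp add: part_def)
  then show ?thesis using assms(2) by (metis card_1_singletonE singletonD)
qed

lemma other_mate:
  assumes "2 \<le> card (part u)"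
  shows "\<exists>v\<in>V. p v = p u \<and> v \<noteq> u"
proof (rule ccontr)
  assume "\<not> ?thesis"
  then have "part u \<subseteq> {u}" by (auto simp: part_def)
  then have "card (part u) \<le> card {u}" by (intro card_mono) auto
  with assms show False by simp
qed

lemma other_mate2:
  assumes "3 \<le> card (part u)"
  shows "\<exists>v\<in>V. p v = p u \<and> v \<noteq> u \<and> v \<noteq> a"
proof (rule ccontr)
  assume "\<not> ?thesis"
  then have "part u \<subseteq> {u, a}" by (auto simp: part_def)
  then have "card (part u) \<le> card {u, a}" by (simp add: card_mono)
  also have "\<dots> \<le> 2" by (simp add: card_insert_if)
  finally show False using assms by simp
qed

lemma other_mate3:
  assumes "4 \<le> card (part u)"
  shows "\<exists>v\<in>V. p v = p u \<and> v \<noteq> u \<and> v \<noteq> a \<and> v \<noteq> b"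
proof (rule ccontr)
  assume "\<not> ?thesis"
  then have "part u \<subseteq> {u, a, b}" by (auto simp: part_def)
  then have "card (part u) \<le> card {u, a, b}" by (simp add: card_mono)
  also have "\<dots> \<le> 3" by (simp add: card_insert_if)
  finally show False using assms by simp
qed

text \<open>An edge covers two vertices. This gives the lower bounds for deletion sets that must
  cover the small parts.\<close>

lemma card_cover_le:
  assumes "B \<subseteq> E" "\<And>u. u \<in> S \<Longrightarrow> \<exists>v. {u, v} \<in> B"
  shows "card S \<le> 2 * card B"
proof -
  have fB: "finite B" using assms(1) finE by (rule finite_subset)
  have fU: "finite (\<Union> B)" by (rule finite_subset[OF _ finV]) (use assms(1) edges in blast)
  have "S \<subseteq> \<Union> B" using assms(2) by blast
  then have "card S \<le> card (\<Union> B)" using fU by (rule card_mono[rotated])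
  also have "\<dots> \<le> (\<Sum>e\<in>B. card e)" using fB by (intro card_Union_le_sum_card)
  also have "\<dots> = (\<Sum>e\<in>B. 2)" using assms(1) edges by (intro sum.cong) auto
  finally show ?thesis by simp
qed

section \<open>Weights 2 and 3: smallest parts of size 1 or 2\<close>

lemma rdn_le_2:
  assumes "u \<in> V" "card (part u) = 1" "B \<subseteq> E" "\<And>v. {u, v} \<notin> B"
  shows "rdn_le V (E - B) 2"
proof (rule rdn_leI[of "{u}" _ "{}"])
  fix v assume v: "v \<in> V" "v \<notin> {u}"
  have "part u = {u}" using assms(1,2) by (rule part_eq_singleton)
  then have "p v \<noteq> p u" using v by (auto simp: part_def)
  then show "\<exists>w\<in>{u}. {v, w} \<in> E - B"
    using assms(1) assms(4)[of v] v by (simp add: edge_iff insert_commute)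
qed (use assms in auto)

lemma rdn_le_3:
  assumes "u \<in> V" "card (part u) = 2" "B \<subseteq> E" "\<And>v. {u, v} \<notin> B"
  shows "rdn_le V (E - B) 3"
proof -
  show ?thesis
  proof (rule rdn_leI[of "{u}" _ "part u - {u}"])
    fix v assume v: "v \<in> V" "v \<notin> {u}" "v \<notin> part u - {u}"
    then show "\<exists>w\<in>{u}. {v, w} \<in> E - B"
      using assms(1) assms(4)[of v] by (auto simp: edge_iff insert_commute part_def)
  qed (use assms in \<open>auto simp: part_def\<close>)
qed

text \<open>A vertex that dominates all others is alone in its part and lies on no edge of
  \<open>B\<close>.\<close>

lemma not_rdn_le_2:
  assumes "3 \<le> card V" "\<And>u. u \<in> V \<Longrightarrow> 2 \<le> card (part u) \<or> (\<exists>v. {u, v} \<in> B)" "B \<subseteq> E"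
  shows "\<not> rdn_le V (E - B) 2"
proof
  assume "rdn_le V (E - B) 2"
  then obtain u where u: "u \<in> V" "\<And>v. v \<in> V \<Longrightarrow> v \<noteq> u \<Longrightarrow> {v, u} \<in> E - B"
    using rdn_le_2D[OF finV assms(1)] by meson
  from assms(2)[OF u(1)] show False
  proof
    assume "2 \<le> card (part u)"
    then show False using other_mate[of u] u(2) by (auto simp: edge_iff)
  next
    assume "\<exists>v. {u, v} \<in> B"
    then obtain v where v: "{u, v} \<in> B" by blast
    then have "{u, v} \<in> E" using assms(3) by blast
    then have "v \<in> V" "v \<noteq> u" by (auto simp: edge_iff)
    then show False using u(2)[of v] v by (simp add: insert_commute)
  qed
qed

text \<open>The only vertex of value 2 may leave one vertex \<open>a\<close> undominated. It would
  leave two: two mates in a part of size at least 3, or its mate and the other end of an edge of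
  \<open>B\<close> in a part of size 2.\<close>

lemma not_rdn_le_3:
  assumes "4 \<le> card V" "B \<subseteq> E"
    and "\<And>u. u \<in> V \<Longrightarrow> 3 \<le> card (part u) \<or> 2 \<le> card (part u) \<and> (\<exists>v. {u, v} \<in> B)"
  shows "\<not> rdn_le V (E - B) 3"
proof
  assume "rdn_le V (E - B) 3"
  then obtain u a where u: "u \<in> V" "\<And>v. v \<in> V \<Longrightarrow> v \<noteq> u \<Longrightarrow> v \<noteq> a \<Longrightarrow> {v, u} \<in> E - B"
    using rdn_le_3D[OF finV assms(1)] by meson
  have mate: "v = a" if "v \<in> V" "p v = p u" "v \<noteq> u" for v
    using u(2)[of v] that by (auto simp: edge_iff)
  from assms(3)[OF u(1)] show False
  proof
    assume "3 \<le> card (part u)"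
    then show False using other_mate2[of u a] mate by blast
  next
    assume *: "2 \<le> card (part u) \<and> (\<exists>v. {u, v} \<in> B)"
    then obtain v where v: "{u, v} \<in> B" by blast
    then have "{u, v} \<in> E" using assms(2) by blast
    then have "v \<in> V" "v \<noteq> u" "p v \<noteq> p u" by (auto simp: edge_iff)
    moreover obtain w where "w \<in> V" "p w = p u" "w \<noteq> u" using other_mate * by blast
    ultimately show False using u(2)[of v] mate[of w] v by (auto simp: insert_commute)
  qed
qed

text \<open>A deletion set has to cover \<open>S\<close>, and each edge covers at most two vertices.
  Vertices of \<open>S\<close> are adjacent to everything, so pairing them up attains the
  bound.\<close>

lemma bondage_min_part_1:
  fixes S :: "'a set"
  defines "S \<equiv> {u\<in>V. card (part u) = 1}"
  assumes "3 \<le> card V" "S \<noteq> {}"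
  shows "roman_bondage_number V E = enat ((card S + 1) div 2)"
proof -
  have finS: "finite S" using finV by (simp add: S_def)
  have adj: "{u, v} \<in> E" if "u \<in> S" "v \<in> V" "u \<noteq> v" for u v
  proof -
    have "part u = {u}" using that(1) by (simp add: S_def part_eq_singleton)
    then show ?thesis using that by (auto simp: edge_iff S_def part_def)
  qed
  obtain x where x: "bij_betw x {0..<card S} S" using ex_bij_betw_nat_finite[OF finS] by blast
  have xS: "x k \<in> S" if "k < card S" for k using x that by (auto simp: bij_betw_def)
  obtain z where z: "z \<in> V" "z \<noteq> x (card S - 1)"
  proof (rule ccontr)
    assume "\<not> thesis"
    with that have "V \<subseteq> {x (card S - 1)}" by blast
    then have "card V \<le> card {x (card S - 1)}" by (intro card_mono) auto
    with assms(2) show False by simp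
  qed
  \<comment> \<open>Consecutive vertices \<open>x (2 * k)\<close> and \<open>x (2 * k + 1)\<close>
    are paired. If \<open>card S\<close> is odd, the last vertex is left over and joined to
    \<open>z\<close>, which may lie anywhere else.\<close>
  define y where "y k = (if 2 * k + 1 < card S then x (2 * k + 1) else z)" for k
  define B where "B = (\<lambda>k. {x (2 * k), y k}) ` {..<(card S + 1) div 2}"
  have "{x (2 * k), y k} \<in> E" if "k < (card S + 1) div 2" for k
  proof (rule adj)
    show "x (2 * k) \<in> S" using that by (intro xS) auto
    show "y k \<in> V" using xS[of "2 * k + 1"] z by (auto simp: y_def S_def)
    show "x (2 * k) \<noteq> y k"
    proof (cases "2 * k + 1 < card S")
      case True
      then show ?thesis
        using inj_onD[OF bij_betw_imp_inj_on[OF x], of "2 * k" "2 * k + 1"] by (auto simp: y_def)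
    next
      case False
      then have "2 * k = card S - 1" using that by auto
      then show ?thesis using z False by (auto simp: y_def)
    qed
  qed
  then have BE: "B \<subseteq> E" by (auto simp: B_def)
  have cover: "\<exists>v. {u, v} \<in> B" if "u \<in> S" for u
  proof -
    have "u \<in> x ` {0..<card S}" using x that by (simp add: bij_betw_def)
    then obtain l where l: "l < card S" "u = x l" by auto
    have k: "l div 2 < (card S + 1) div 2" using l by auto
    show ?thesis
    proof (cases "even l")
      case True
      then have "{u, y (l div 2)} \<in> B" using k l by (auto simp: B_def)
      then show ?thesis by blast
    next
      case False
      then have "y (l div 2) = u" using l by (auto simp: y_def)
      moreover have "{x (2 * (l div 2)), y (l div 2)} \<in> B" using k by (auto simp: B_def)
      ultimately show ?thesis by (metis insert_commute)
    qed
  qed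
  have part2: "2 \<le> card (part u) \<or> u \<in> S" if "u \<in> V" for u
  proof -
    have "u \<in> part u" using that by (simp add: part_def)
    then have "card (part u) \<noteq> 0" by auto
    then show ?thesis using that unfolding S_def by (simp, linarith)
  qed
  show ?thesis
  proof (rule roman_bondage_number_eqI[where k = 1, OF simple _ _ BE])
    obtain u where "u \<in> S" using assms(3) by blast
    then show "rdn_le V E (Suc 1)"
      using rdn_le_2[of u "{}"] by (simp add: S_def numeral_2_eq_2)
    show "\<not> rdn_le V E 1" using finV assms(2) by (intro not_rdn_le_1) auto
    show "card B \<le> (card S + 1) div 2"
      unfolding B_def by (rule order_trans[OF card_image_le]) auto
    show "\<not> rdn_le V (E - B) (Suc 1)"
      using not_rdn_le_2[OF assms(2) _ BE] part2 cover unfolding Suc_1 by blast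
    fix C assume C: "C \<subseteq> E" "\<not> rdn_le V (E - C) (Suc 1)"
    have "\<exists>v. {u, v} \<in> C" if "u \<in> S" for u
      using rdn_le_2[of u C] C that by (auto simp: S_def numeral_2_eq_2)
    then have "card S \<le> 2 * card C" by (rule card_cover_le[OF C(1)])
    then show "(card S + 1) div 2 \<le> card C" by linarith
  qed
qed

text \<open>Reduces the problem to the least number of edges covering the parts of size 2. The value
  \<open>c\<close> stays open because a single such part needs a different count from
  several.\<close>

lemma bondage_min_part_2:
  assumes "4 \<le> card V" "\<And>u. u \<in> V \<Longrightarrow> 2 \<le> card (part u)"
    and "\<exists>u\<in>V. card (part u) = 2"
    and B: "B \<subseteq> E" "card B \<le> c" "\<And>u. u \<in> V \<Longrightarrow> card (part u) = 2 \<Longrightarrow> \<exists>v. {u, v} \<in> B"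
    and lower: "\<And>C. C \<subseteq> E \<Longrightarrow> (\<And>u. u \<in> V \<Longrightarrow> card (part u) = 2 \<Longrightarrow> \<exists>v. {u, v} \<in> C) \<Longrightarrow>
      c \<le> card C"
  shows "roman_bondage_number V E = enat c"
proof (rule roman_bondage_number_eqI[where k = 2, OF simple _ _ B(1,2)])
  have 3: "Suc 2 = 3" by simp
  obtain u where "u \<in> V" "card (part u) = 2" using assms(3) by blast
  then show "rdn_le V E (Suc 2)" using rdn_le_3[of u "{}"] by (simp add: 3)
  show "\<not> rdn_le V E 2" using not_rdn_le_2[of "{}"] assms(1,2) by simp
  have "3 \<le> card (part u) \<or> 2 \<le> card (part u) \<and> (\<exists>v. {u, v} \<in> B)" if "u \<in> V" for u
    using assms(2)[OF that] B(3)[OF that] by (cases "card (part u) = 2") auto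
  then show "\<not> rdn_le V (E - B) (Suc 2)" using not_rdn_le_3[OF assms(1) B(1)] by (simp add: 3)
  fix C assume C: "C \<subseteq> E" "\<not> rdn_le V (E - C) (Suc 2)"
  have "\<exists>v. {u, v} \<in> C" if "u \<in> V" "card (part u) = 2" for u
    using rdn_le_3[of u C] C that by (auto simp: 3)
  then show "c \<le> card C" by (rule lower[OF C(1)])
qed

section \<open>Weight 4: dominating pairs and isolated vertices\<close>

lemma rdn_le_4_pair:
  assumes "F \<subseteq> E" "u \<in> V" "v \<in> V"
    and "\<And>w. w \<in> V \<Longrightarrow> w \<noteq> u \<Longrightarrow> w \<noteq> v \<Longrightarrow> {u, w} \<in> F \<or> {v, w} \<in> F"
  shows "rdn_le V F 4"
proof (rule rdn_leI[of "{u, v}" _ "{}"])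
  fix w assume "w \<in> V" "w \<notin> {u, v}"
  then show "\<exists>x\<in>{u, v}. {w, x} \<in> F" using assms(4)[of w] by (auto simp: insert_commute)
qed (use assms in \<open>auto simp: card_insert_if\<close>)

lemma rdn_le_4:
  assumes "p u \<noteq> p v" "u \<in> V" "v \<in> V"
  shows "rdn_le V E 4"
  by (rule rdn_le_4_pair[OF _ assms(2,3)]) (use assms in \<open>auto simp: edge_iff\<close>)

text \<open>The isolated vertex \<open>x\<close> must have positive value itself. The rest of the
  weight is too small for a further vertex \<open>v\<close> of value 2 together with the two
  non-neighbours of \<open>v\<close> from \<open>two\<close>.\<close>

lemma not_rdn_le_4_isolated:
  assumes "6 \<le> card V" "x \<in> V" "\<And>v. {x, v} \<notin> F"
    and two: "\<And>v. v \<in> V \<Longrightarrow> v \<noteq> x \<Longrightarrow> \<exists>a\<in>V. \<exists>b\<in>V. a \<noteq> b \<and> a \<noteq> x \<and> b \<noteq> x \<and> a \<noteq> v \<and> b \<noteq> v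
      \<and> {v, a} \<notin> F \<and> {v, b} \<notin> F"
  shows "\<not> rdn_le V F 4"
proof
  assume "rdn_le V F 4"
  then obtain X Y where XY: "X \<subseteq> V" "Y \<subseteq> V" "2 * card X + card Y \<le> 4" "1 \<le> card X"
    "\<And>u. u \<in> V \<Longrightarrow> u \<notin> X \<Longrightarrow> u \<notin> Y \<Longrightarrow> \<exists>v\<in>X. {u, v} \<in> F"
    by (rule rdn_leE[OF _ _ finV]) (use assms(1) in auto)
  have fin: "finite X" "finite Y" using XY(1,2) finV finite_subset by blast+
  have "x \<in> X \<or> x \<in> Y" using XY(5)[OF assms(2)] assms(3) by blast
  show False
  \<comment> \<open>If \<open>x\<close> alone has value 2, it dominates no other vertex, so all
    others have value 1; weight 4 then allows at most three vertices.\<close>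
  proof (cases "X = {x}")
    case True
    have "V \<subseteq> insert x Y"
    proof
      fix u assume "u \<in> V"
      then show "u \<in> insert x Y" using XY(5)[of u] True assms(3)[of u] by (auto simp: insert_commute)
    qed
    then have "card V \<le> card (insert x Y)" using fin by (intro card_mono) auto
    then show False using XY(3,4) assms(1) fin by (auto simp: card_insert_if split: if_splits)
  next
    case False
    then obtain v where v: "v \<in> X" "v \<noteq> x" using XY(4) by (cases "X = {}") auto
    \<comment> \<open>Either \<open>x\<close> has value 2, which forces \<open>X = {x, v}\<close>
      and an empty \<open>Y\<close>, or \<open>x\<close> has value 1, which forces
      \<open>X = {v}\<close> and leaves room for one more vertex in \<open>Y\<close>.\<close>
    have sub: "X \<subseteq> {x, v}" and Yx: "card (Y - {x}) \<le> 1"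
    proof -
      have "card (X - {x, v}) + card ({x, v} \<inter> X) = card X"
        using fin card_Diff_subset_Int[of "X" "{x, v}"]
        by (metis Int_commute card_Int_Diff add.commute)
      moreover have "1 \<le> card ({x, v} \<inter> X)"
        using v fin by (metis Int_iff One_nat_def Suc_leI card_gt_0_iff empty_iff finite_Int insertCI)
      moreover have "x \<in> X \<Longrightarrow> card ({x, v} \<inter> X) = 2" using v by (simp add: card_insert_if)
      moreover have "x \<in> Y \<Longrightarrow> card (Y - {x}) + 1 = card Y"
        using fin by (metis card_Suc_Diff1 Suc_eq_plus1)
      moreover have "card (Y - {x}) \<le> card Y" using fin by (simp add: card_mono)
      ultimately have "card (X - {x, v}) = 0 \<and> card (Y - {x}) \<le> 1"
        using XY(3) \<open>x \<in> X \<or> x \<in> Y\<close> by linarith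
      then show "X \<subseteq> {x, v}" "card (Y - {x}) \<le> 1" using fin by auto
    qed
    obtain a b where ab: "a \<in> V" "b \<in> V" "a \<noteq> b" "a \<noteq> x" "b \<noteq> x" "a \<noteq> v" "b \<noteq> v"
      "{v, a} \<notin> F" "{v, b} \<notin> F"
      using two[of v] v XY(1) by blast
    have "w \<in> Y" if "w \<in> V" "w \<noteq> x" "w \<noteq> v" "{v, w} \<notin> F" for w
    proof (rule ccontr)
      assume "w \<notin> Y"
      moreover have "w \<notin> X" using sub that by auto
      ultimately obtain u where "u \<in> X" "{u, w} \<in> F"
        using XY(5)[of w] \<open>w \<in> V\<close> \<open>w \<notin> Y\<close> by (auto simp: insert_commute)
      then show False using sub that(4) assms(3)[of w] by blast
    qed
    then have "{a, b} \<subseteq> Y - {x}" using ab by blast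
    then have "card {a, b} \<le> card (Y - {x})" using fin by (intro card_mono) auto
    then show False using Yx ab by simp
  qed
qed

end

section \<open>Deleted edge sets destroying all dominating pairs\<close>

locale critical = multipartite +
  fixes B :: "'a set set"
  assumes B_sub: "B \<subseteq> E" and crit: "\<not> rdn_le V (E - B) 4"
begin

text \<open>Adjacency along the deleted edges, not in the given graph.\<close>

definition adj :: "'a \<Rightarrow> 'a \<Rightarrow> bool" where
  "adj u v \<longleftrightarrow> {u, v} \<in> B"

text \<open>A vertex of degree one in the graph with edge set \<open>B\<close>; its neighbour
  \<open>w\<close> is called its hub.\<close>

definition leaf :: "'a \<Rightarrow> 'a \<Rightarrow> bool" where
  "leaf u w \<longleftrightarrow> adj u w \<and> (\<forall>x. adj u x \<longrightarrow> x = w)"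

lemma adj_sym: "adj u v \<Longrightarrow> adj v u"
  by (simp add: adj_def insert_commute)

lemma adjD: "adj u v \<Longrightarrow> u \<in> V \<and> v \<in> V \<and> p u \<noteq> p v"
  using B_sub edge_iff[of u v] by (auto simp: adj_def)

lemma leafD: "leaf u w \<Longrightarrow> adj u w \<and> u \<in> V \<and> w \<in> V \<and> p w \<noteq> p u \<and> p u \<noteq> p w"
  using adjD[of u w] by (simp add: leaf_def)

lemma leaf_eq: "leaf u w \<Longrightarrow> adj u x \<Longrightarrow> x = w"
  by (simp add: leaf_def)

lemma leaf_eq': "leaf u w \<Longrightarrow> adj x u \<Longrightarrow> x = w"
  using adj_sym leaf_eq by blast

lemma finB: "finite B"
  using B_sub finE by (rule finite_subset)

text \<open>Otherwise value 2 on \<open>u\<close> and \<open>v\<close> alone would dominate the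
  remaining graph. Being non-adjacent after the deletion means sharing a part or being joined by a
  deleted edge.\<close>

lemma witness:
  assumes "u \<in> V" "v \<in> V"
  obtains x where "x \<in> V" "x \<noteq> u" "x \<noteq> v" "p u = p x \<or> adj u x" "p v = p x \<or> adj v x"
proof -
  have "\<exists>w\<in>V. w \<noteq> u \<and> w \<noteq> v \<and> {u, w} \<notin> E - B \<and> {v, w} \<notin> E - B"
    using rdn_le_4_pair[of "E - B" u v] crit assms by blast
  then show thesis using that assms unfolding adj_def edge_iff Diff_iff by blast
qed

text \<open>The witness for \<open>u\<close> and \<open>v\<close> lies in the part of
  \<open>u\<close>, as no deleted edge meets \<open>u\<close>; hence it is joined to
  \<open>v\<close> by a deleted edge. Edges for different \<open>v\<close> differ, since each has
  only one end outside that part.\<close>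

lemma isolated_card:
  assumes "u \<in> V" "\<And>w. \<not> adj u w"
  shows "card V - card (part u) \<le> card B"
proof -
  have "\<exists>x. adj v x \<and> p x = p u" if "v \<in> V - part u" for v
    using witness[of u v] assms that by (auto simp: part_def) metis
  then obtain g where g: "adj v (g v)" "p (g v) = p u" if "v \<in> V - part u" for v
    by metis
  have "inj_on (\<lambda>v. {v, g v}) (V - part u)"
  proof (rule inj_onI)
    fix v v' assume v: "v \<in> V - part u" "v' \<in> V - part u" "{v, g v} = {v', g v'}"
    have "g v \<noteq> v'" using g(2)[OF v(1)] v(2) by (auto simp: part_def)
    then show "v = v'" using v(3) by (auto simp: doubleton_eq_iff)
  qed
  then have "card (V - part u) \<le> card B"
    by (rule card_inj_on_le) (use g(1) finB in \<open>auto simp: adj_def\<close>)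
  then show ?thesis by (simp add: card_minus_part)
qed

text \<open>
  Every vertex \<open>v\<close> outside the part of the leaf \<open>u\<close> is charged a private edge \<open>{v, g v}\<close> of \<open>B\<close>,
  different from the edge \<open>{u, w}\<close>.
\<close>

definition charge :: "'a \<Rightarrow> 'a \<Rightarrow> ('a \<Rightarrow> 'a) \<Rightarrow> bool" where
  "charge u w g \<longleftrightarrow> (\<forall>v\<in>V. p v \<noteq> p u \<longrightarrow> adj v (g v) \<and>
     (p v \<noteq> p w \<longrightarrow> g v = w \<or> p (g v) = p u \<and> g v \<noteq> u)) \<and> p (g w) = p u \<and> g w \<noteq> u"

lemma chargeD:
  assumes "charge u w g"
  shows "v \<in> V \<Longrightarrow> p v \<noteq> p u \<Longrightarrow> adj v (g v)"
    and "v \<in> V \<Longrightarrow> p v \<noteq> p u \<Longrightarrow> p v \<noteq> p w \<Longrightarrow> g v = w \<or> p (g v) = p u \<and> g v \<noteq> u"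
    and "p (g w) = p u" "g w \<noteq> u"
  using assms by (simp_all add: charge_def)

text \<open>The witness for \<open>u\<close> and \<open>v\<close> lies in the part of
  \<open>u\<close> or is the hub \<open>w\<close>, and usually a deleted edge joins it to
  \<open>v\<close>. The exception is a vertex \<open>v\<close> other than \<open>w\<close> in the
  part of \<open>w\<close>, for which \<open>cover\<close> supplies an arbitrary edge.\<close>

lemma leaf_charge:
  assumes leaf: "leaf u w" and cover: "\<And>v. v \<in> V \<Longrightarrow> \<exists>x. adj v x"
  obtains g where "charge u w g"
    and "inj_on (\<lambda>v. {v, g v}) (V - part u)"
    and "{u, w} \<notin> (\<lambda>v. {v, g v}) ` (V - part u)"
proof -
  have uw: "adj u w" "u \<in> V" "w \<in> V" "p u \<noteq> p w" using leafD[OF leaf] by simp_all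
  have "\<exists>x. adj v x \<and> (p v \<noteq> p w \<longrightarrow> x = w \<or> p x = p u \<and> x \<noteq> u) \<and> (v = w \<longrightarrow> p x = p u \<and> x \<noteq> u)"
    if v: "v \<in> V" "p v \<noteq> p u" for v
  proof (cases "p v = p w \<and> v \<noteq> w")
    case True
    then show ?thesis using cover[OF v(1)] by auto
  next
    case False
    obtain x where x: "x \<in> V" "x \<noteq> u" "x \<noteq> v" "p u = p x \<or> adj u x" "p v = p x \<or> adj v x"
      using witness[OF uw(2) v(1)] by blast
    show ?thesis
    proof (cases "p u = p x")
      case True
      then have "adj v x" using x v by auto
      then show ?thesis using True x by auto
    next
      case xu: False
      then have "x = w" using x(4) leaf leaf_eq by blast
      then have "p v \<noteq> p x" using False x(3) by auto
      then show ?thesis using x \<open>x = w\<close> by auto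
    qed
  qed
  then obtain g where g0: "\<And>v. v \<in> V \<Longrightarrow> p v \<noteq> p u \<Longrightarrow> adj v (g v) \<and>
    (p v \<noteq> p w \<longrightarrow> g v = w \<or> p (g v) = p u \<and> g v \<noteq> u) \<and> (v = w \<longrightarrow> p (g v) = p u \<and> g v \<noteq> u)"
    by metis
  then have charge: "charge u w g" using uw by (auto simp: charge_def)
  note g = chargeD[OF this]
  \<comment> \<open>If an edge were charged from both ends, one end would lie outside the part of
    \<open>w\<close>, so the other end would be \<open>w\<close>; but \<open>g w\<close> lies in the
    part of \<open>u\<close>.\<close>
  have swap: "v = v'" if "v \<in> V" "v' \<in> V" "p v \<noteq> p u" "p v' \<noteq> p u" "g v = v'" "g v' = v" for v v'
  proof -
    have ne: "p v \<noteq> p v'" using g(1)[OF that(1,3)] that(5) adjD by metis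
    have "v' = w" if "p v \<noteq> p w" using g(2)[of v] \<open>g v = v'\<close> that \<open>v \<in> V\<close> \<open>p v \<noteq> p u\<close> \<open>p v' \<noteq> p u\<close> by auto
    moreover have "v = w" if "p v' \<noteq> p w"
      using g(2)[of v'] \<open>g v' = v\<close> that \<open>v' \<in> V\<close> \<open>p v \<noteq> p u\<close> \<open>p v' \<noteq> p u\<close> by auto
    ultimately show ?thesis using ne g(3) that by metis
  qed
  have "inj_on (\<lambda>v. {v, g v}) (V - part u)"
  proof (rule inj_onI)
    fix v v' assume v: "v \<in> V - part u" "v' \<in> V - part u" "{v, g v} = {v', g v'}"
    show "v = v'"
    proof (rule ccontr)
      assume "v \<noteq> v'"
      then have "g v = v'" "g v' = v" using v(3) by (auto simp: doubleton_eq_iff)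
      then show False using swap[of v v'] v \<open>v \<noteq> v'\<close> by (auto simp: part_def)
    qed
  qed
  moreover have "{u, w} \<notin> (\<lambda>v. {v, g v}) ` (V - part u)"
  proof
    assume "{u, w} \<in> (\<lambda>v. {v, g v}) ` (V - part u)"
    then obtain v where "v \<in> V - part u" "{u, w} = {v, g v}" by blast
    then have "v = w" "g v = u" by (auto simp: doubleton_eq_iff part_def)
    then show False using g(4) by simp
  qed
  ultimately show thesis using charge that by blast
qed

lemma leaf_card:
  assumes "leaf u w" "\<And>v. v \<in> V \<Longrightarrow> \<exists>x. adj v x"
  shows "card V - card (part u) + 1 \<le> card B"
proof -
  obtain g where g: "charge u w g"
    "inj_on (\<lambda>v. {v, g v}) (V - part u)" "{u, w} \<notin> (\<lambda>v. {v, g v}) ` (V - part u)"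
    using leaf_charge[OF assms] by blast
  have "insert {u, w} ((\<lambda>v. {v, g v}) ` (V - part u)) \<subseteq> B"
    using chargeD(1)[OF g(1)] assms(1) by (auto simp: adj_def leaf_def part_def)
  then have "card (insert {u, w} ((\<lambda>v. {v, g v}) ` (V - part u))) \<le> card B"
    using finB by (rule card_mono[rotated])
  moreover have "card (insert {u, w} ((\<lambda>v. {v, g v}) ` (V - part u)))
      = card V - card (part u) + 1"
    using g(2,3) finV by (simp add: card_image card_minus_part)
  ultimately show ?thesis by simp
qed

text \<open>Otherwise every vertex lies on at least two edges of \<open>B\<close>, and counting
  incidences twice gives \<open>card V \<le> card B\<close>.\<close>

lemma leaf_exists:
  assumes "card B < card V" "\<And>v. v \<in> V \<Longrightarrow> \<exists>x. adj v x"
  obtains u w where "leaf u w"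
proof (rule ccontr)
  assume "\<not> thesis"
  then have nl: "\<not> leaf u w" for u w using that by blast
  let ?I = "\<lambda>v. {e\<in>B. v \<in> e}"
  have two: "2 \<le> card (?I v)" if v: "v \<in> V" for v
  proof -
    obtain x where x: "adj v x" using assms(2)[OF v] by blast
    obtain y where y: "adj v y" "y \<noteq> x" using nl[of v x] x by (auto simp: leaf_def)
    have "{{v, x}, {v, y}} \<subseteq> ?I v" using x y by (auto simp: adj_def)
    then have "card {{v, x}, {v, y}} \<le> card (?I v)" using finB by (intro card_mono) auto
    then show ?thesis using y(2) by (simp add: doubleton_eq_iff card_insert_if)
  qed
  have "2 * card V = (\<Sum>v\<in>V. 2)" by simp
  also have "\<dots> \<le> (\<Sum>v\<in>V. card (?I v))" using two by (rule sum_mono)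
  also have "\<dots> = (\<Sum>v\<in>V. \<Sum>e\<in>B. if v \<in> e then 1 else 0)"
    using finB by (simp add: sum.If_cases Int_def)
  also have "\<dots> = (\<Sum>e\<in>B. \<Sum>v\<in>V. if v \<in> e then 1 else 0)" by (rule sum.swap)
  also have "\<dots> = (\<Sum>e\<in>B. 2)"
  proof (rule sum.cong)
    fix e assume "e \<in> B"
    then have "e \<subseteq> V" "card e = 2" using edges B_sub by auto
    then show "(\<Sum>v\<in>V. if v \<in> e then 1 else 0) = (2::nat)"
      using finV by (simp add: sum.If_cases Int_absorb1)
  qed simp
  finally show False using assms(1) by simp
qed

text \<open>An uncovered vertex gives the bound by \<open>isolated_card\<close>. Otherwise
  \<open>leaf_exists\<close> provides a leaf, and \<open>leaf_card\<close> gives even one edge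
  more.\<close>

lemma card_ge_minus_part:
  assumes "\<And>u. u \<in> V \<Longrightarrow> card (part u) \<le> k"
  shows "card V - k \<le> card B"
proof (rule ccontr)
  assume less: "\<not> ?thesis"
  have cover: "\<exists>x. adj v x" if "v \<in> V" for v
    using isolated_card[OF that] assms(1)[OF that] less by force
  have "card B < card V" using less by linarith
  then obtain u w where l: "leaf u w" using leaf_exists cover by blast
  then have "u \<in> V" using leafD by blast
  with leaf_card[OF l cover] assms(1)[of u] less show False by simp
qed

end

section \<open>Parts of size three\<close>

text \<open>
  The bound for leaves then gives \<open>card B \<ge> card V - 2\<close>; the locale treats the case of equality.
\<close>

locale tight = critical +
  assumes part3: "\<And>u. u \<in> V \<Longrightarrow> card (part u) = 3"
    and cover: "\<And>v. v \<in> V \<Longrightarrow> \<exists>x. adj v x"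
    and card_B: "card B + 2 \<le> card V"
    and third: "\<And>u v. u \<in> V \<Longrightarrow> v \<in> V \<Longrightarrow> \<exists>w\<in>V. p w \<noteq> p u \<and> p w \<noteq> p v"
begin

text \<open>The charged edges together with \<open>{u, w}\<close> already number
  \<open>card V - 2\<close>, so they exhaust \<open>B\<close>. Hence every deleted edge avoiding
  \<open>u\<close> is charged by one of its ends.\<close>

lemma tight_charge:
  assumes leaf: "leaf u w"
  obtains g where "charge u w g"
    and "\<forall>v d. adj v d \<longrightarrow> v = u \<or> d = u \<or> p v \<noteq> p u \<and> d = g v \<or> p d \<noteq> p u \<and> v = g d"
proof -
  obtain g where g: "charge u w g"
    "inj_on (\<lambda>v. {v, g v}) (V - part u)" "{u, w} \<notin> (\<lambda>v. {v, g v}) ` (V - part u)"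
    using leaf_charge[OF leaf cover] by blast
  have uV: "u \<in> V" using leafD[OF leaf] by simp_all
  let ?C = "insert {u, w} ((\<lambda>v. {v, g v}) ` (V - part u))"
  have "?C \<subseteq> B"
    using chargeD(1)[OF g(1)] leaf by (auto simp: adj_def leaf_def part_def)
  moreover have "card ?C = card V - 2"
  proof -
    have "3 \<le> card V" using part3[OF uV] card_mono[OF finV, of "part u"] by (auto simp: part_def)
    moreover have "card ?C = card V - card (part u) + 1"
      using g(2,3) finV by (simp add: card_image card_minus_part)
    ultimately show ?thesis using part3[OF uV] by simp
  qed
  ultimately have "?C = B" using card_B finB by (intro card_seteq) auto
  have "v = u \<or> d = u \<or> p v \<noteq> p u \<and> d = g v \<or> p d \<noteq> p u \<and> v = g d" if "adj v d" for v d
  proof -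
    have "{v, d} \<in> ?C" using that \<open>?C = B\<close> by (simp add: adj_def)
    then show ?thesis by (auto simp: doubleton_eq_iff part_def)
  qed
  with g(1) that show thesis by blast
qed

text \<open>A deleted edge from \<open>w\<close> to a vertex of the part of \<open>u\<close> other
  than \<open>u\<close> can only be charged by \<open>w\<close>, so it is
  \<open>{w, g w}\<close>.\<close>

lemma hub_mate:
  assumes "leaf u w"
  shows "\<exists>!a. p a = p u \<and> a \<noteq> u \<and> adj w a"
proof -
  obtain g where c: "charge u w g" and
    d: "\<forall>v d. adj v d \<longrightarrow> v = u \<or> d = u \<or> p v \<noteq> p u \<and> d = g v \<or> p d \<noteq> p u \<and> v = g d"
    using tight_charge[OF assms] by blast
  note g = chargeD[OF c] d[rule_format]
  have w: "w \<in> V" "p w \<noteq> p u" using leafD[OF assms(1)] by simp_all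
  show ?thesis
  proof
    show "p (g w) = p u \<and> g w \<noteq> u \<and> adj w (g w)" using g(1)[of w] g(3,4) w by simp
    fix a assume "p a = p u \<and> a \<noteq> u \<and> adj w a"
    then show "a = g w" using g(5)[of w a] w by auto
  qed
qed

text \<open>A deleted edge at \<open>c\<close> not charged by \<open>c\<close> would be charged by
  its other end, which lies outside the parts of \<open>u\<close> and \<open>w\<close>; but such a
  vertex charges an edge to \<open>w\<close> or into the part of \<open>u\<close>.\<close>

lemma mate_of_hub_leaf:
  assumes "leaf u w" "c \<in> V" "p c = p w" "c \<noteq> w"
  shows "\<exists>d. leaf c d"
proof -
  obtain g where c: "charge u w g" and
    d: "\<forall>v d. adj v d \<longrightarrow> v = u \<or> d = u \<or> p v \<noteq> p u \<and> d = g v \<or> p d \<noteq> p u \<and> v = g d"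
    using tight_charge[OF assms(1)] by blast
  note g = chargeD[OF c] d[rule_format]
  have w: "p w \<noteq> p u" using leafD[OF assms(1)] by simp_all
  have "d = g c" if cd: "adj c d" for d
  proof (rule ccontr)
    assume "d \<noteq> g c"
    have "d \<noteq> u" using leaf_eq'[OF assms(1), of c] cd assms(4) by blast
    then have d: "p d \<noteq> p u" "c = g d" using g(5)[OF cd] assms w \<open>d \<noteq> g c\<close> by auto
    have "d \<in> V" "p d \<noteq> p w" using adjD[OF cd] assms(3) by auto
    then show False using g(2)[of d] d assms w by auto
  qed
  moreover have "adj c (g c)" using g(1)[of c] assms(2,3) w by simp
  ultimately show ?thesis unfolding leaf_def by blast
qed

text \<open>The vertex \<open>x\<close> is \<open>g v\<close>. Any further deleted edge at
  \<open>v\<close> is charged by its other end, which must then lie in the part of \<open>w\<close>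
  and differ from \<open>w\<close>.\<close>

lemma third_part_neighbour:
  assumes "leaf u w" "v \<in> V" "p v \<noteq> p u" "p v \<noteq> p w"
  shows "\<exists>x. (x = w \<or> p x = p u \<and> x \<noteq> u) \<and> adj v x \<and>
    (\<forall>d. adj v d \<longrightarrow> p d \<noteq> p w \<or> d = w \<longrightarrow> d = x)"
proof -
  obtain g where c: "charge u w g" and
    d: "\<forall>v d. adj v d \<longrightarrow> v = u \<or> d = u \<or> p v \<noteq> p u \<and> d = g v \<or> p d \<noteq> p u \<and> v = g d"
    using tight_charge[OF assms(1)] by blast
  note g = chargeD[OF c] d[rule_format]
  have "d = g v" if d: "adj v d" "p d \<noteq> p w \<or> d = w" for d
  proof (rule ccontr)
    assume "d \<noteq> g v"
    have "d \<noteq> u" using leaf_eq'[OF assms(1)] d(1) assms(4) by auto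
    then have *: "p d \<noteq> p u" "v = g d" using g(5)[OF d(1)] assms \<open>d \<noteq> g v\<close> by auto
    have "d \<in> V" using adjD[OF d(1)] by auto
    then show False using g(2)[of d] * g(3) assms d(2) by auto
  qed
  then show ?thesis using g(1,2)[of v] assms by blast
qed

lemma third_part_unique:
  assumes "leaf u w" "v \<in> V" "p v \<noteq> p u" "p v \<noteq> p w" "adj v d" "adj v d'"
    "p d \<noteq> p w \<or> d = w" "p d' \<noteq> p w \<or> d' = w"
  shows "d = d'"
  using third_part_neighbour[OF assms(1-4)] assms(5-8) by blast

lemma mates:
  assumes "u \<in> V"
  obtains v w where "v \<in> V" "w \<in> V" "p v = p u" "p w = p u" "u \<noteq> v" "u \<noteq> w" "v \<noteq> w"
    "\<And>x. x \<in> V \<Longrightarrow> p x = p u \<Longrightarrow> x = u \<or> x = v \<or> x = w"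
proof -
  obtain a b c where abc: "part u = {a, b, c}" "a \<noteq> b" "a \<noteq> c" "b \<noteq> c"
    using part3[OF assms] by (auto simp: card_3_iff)
  have mem: "x \<in> {a, b, c} \<longleftrightarrow> x \<in> V \<and> p x = p u" for x
    using abc(1) by (auto simp: part_def)
  have "u = a \<or> u = b \<or> u = c" using mem[of u] assms by auto
  then show thesis
  proof (elim disjE)
    assume "u = a" then show thesis using that[of b c] mem abc by auto
  next
    assume "u = b" then show thesis using that[of a c] mem abc by auto
  next
    assume "u = c" then show thesis using that[of a b] mem abc by auto
  qed
qed

text \<open>The hub of a leaf has exactly two neighbours in the part of the leaf, and 3 is odd.\<close>

lemma not_all_leaves:
  assumes "u \<in> V"
  shows "\<exists>v\<in>V. p v = p u \<and> (\<forall>x. \<not> leaf v x)"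
proof (rule ccontr)
  assume "\<not> ?thesis"
  then have all: "\<exists>x. leaf v x" if "v \<in> V" "p v = p u" for v using that by blast
  obtain v w where m: "v \<in> V" "w \<in> V" "p v = p u" "p w = p u" "u \<noteq> v" "u \<noteq> w" "v \<noteq> w"
    "\<And>x. x \<in> V \<Longrightarrow> p x = p u \<Longrightarrow> x = u \<or> x = v \<or> x = w"
    using mates[OF assms] by blast
  obtain x y z where l: "leaf u x" "leaf v y" "leaf w z" using all m assms by metis
  \<comment> \<open>A leaf is joined to \<open>x\<close> only if \<open>x\<close> is its hub, so by
    \<open>hub_mate\<close> exactly one of \<open>v\<close> and \<open>w\<close> shares the hub of
    \<open>u\<close>. The other one must still share its hub with somebody, which is
    impossible.\<close>
  have ux: "(x = y) \<noteq> (x = z)"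
  proof -
    obtain a where a: "p a = p u" "a \<noteq> u" "adj x a"
      "\<And>b. p b = p u \<Longrightarrow> b \<noteq> u \<Longrightarrow> adj x b \<Longrightarrow> b = a" using hub_mate[OF l(1)] by blast
    have "a = v \<or> a = w" using m(8)[of a] a adjD by blast
    moreover have "adj y v" "adj z w" using l adj_sym by (auto simp: leaf_def)
    ultimately show ?thesis using a m leaf_eq'[OF l(2), of x] leaf_eq'[OF l(3), of x] by metis
  qed
  have wz: "z = x \<or> z = y"
  proof -
    obtain a where a: "p a = p w" "a \<noteq> w" "adj z a" using hub_mate[OF l(3)] by blast
    have "a = u \<or> a = v" using m(4) m(8)[of a] a adjD by metis
    then show ?thesis using a leaf_eq'[OF l(2), of z] leaf_eq'[OF l(1), of z] by metis
  qed
  have vy: "y = x \<or> y = z"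
  proof -
    obtain a where a: "p a = p v" "a \<noteq> v" "adj y a" using hub_mate[OF l(2)] by blast
    have "a = u \<or> a = w" using m(3) m(8)[of a] a adjD by metis
    then show ?thesis using a leaf_eq'[OF l(3), of y] leaf_eq'[OF l(1), of y] by metis
  qed
  show False using ux wz vy by auto
qed

text \<open>If \<open>x\<close> were joined to \<open>a\<close>, then \<open>a\<close> would be its
  only extra neighbour, so \<open>c\<close> would have another hub \<open>y\<close>, with extra
  neighbour \<open>a\<close> again. With two neighbours \<open>a\<close> and \<open>c\<close>, this
  \<open>y\<close> fits neither into the part of \<open>x\<close> (\<open>mate_of_hub_leaf\<close>)
  nor into a third part (\<open>third_part_unique\<close>). So the extra neighbour of
  \<open>x\<close> is \<open>c\<close>.\<close>

lemma leaf_mates: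
  assumes l: "leaf b x" "leaf c y" and bc: "p b = p c" "b \<noteq> c"
    and a: "a \<in> V" "p a = p b" "a \<noteq> b" "a \<noteq> c"
  shows "x = y" "\<not> adj x a"
proof -
  have V: "b \<in> V" "c \<in> V" "x \<in> V" "y \<in> V" "p x \<noteq> p b" "p y \<noteq> p b" "adj x b" "adj y c"
    using l bc adjD[of b x] adjD[of c y] adj_sym[of b x] adj_sym[of c y] by (simp_all add: leaf_def)
  have cases: "d = a \<or> d = b \<or> d = c" if "d \<in> V" "p d = p b" for d
    using mates[OF a(1)] a bc V that by metis
  have "\<not> adj x a"
  proof
    assume xa: "adj x a"
    then have "\<not> adj x c" using hub_mate[OF l(1)] a bc by metis
    then have "x \<noteq> y" using V by blast
    obtain d where d: "p d = p c" "d \<noteq> c" "adj y d" using hub_mate[OF l(2)] by blast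
    then have "d = a \<or> d = b" using cases[of d] adjD bc by metis
    then have ya: "adj y a" using leaf_eq'[OF l(1), of y] d \<open>x \<noteq> y\<close> by blast
    show False
    proof (cases "p y = p x")
      case True
      then obtain e where "leaf y e" using mate_of_hub_leaf[OF l(1), of y] V \<open>x \<noteq> y\<close> by blast
      then show False using leaf_eq ya V(8) a(4) by blast
    next
      case False
      then show False
        using third_part_unique[OF l(1) V(4,6) False ya V(8)] a bc V by metis
    qed
  qed
  obtain d where d: "p d = p b" "d \<noteq> b" "adj x d" using hub_mate[OF l(1)] by blast
  then have "d = c" using cases[of d] adjD \<open>\<not> adj x a\<close> by blast
  then show "x = y" using leaf_eq'[OF l(2)] d by blast
  show "\<not> adj x a" by fact
qed

text \<open>The mates of the hub are leaves by \<open>mate_of_hub_leaf\<close> and share a hub by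
  \<open>leaf_mates\<close>. The lemma applies again to these leaves, so hubs can be followed from
  part to part.\<close>

lemma hub_part:
  assumes "leaf u a"
  shows "\<exists>b c x. p b = p a \<and> p c = p a \<and> a \<noteq> b \<and> a \<noteq> c \<and> b \<noteq> c \<and>
    part a = {a, b, c} \<and> leaf b x \<and> leaf c x \<and> \<not> adj x a \<and> p x \<noteq> p a \<and> a \<in> V"
proof -
  have aV: "a \<in> V" using leafD[OF assms] by simp
  obtain b c where m: "b \<in> V" "c \<in> V" "p b = p a" "p c = p a" "a \<noteq> b" "a \<noteq> c" "b \<noteq> c"
    "\<And>d. d \<in> V \<Longrightarrow> p d = p a \<Longrightarrow> d = a \<or> d = b \<or> d = c"
    using mates[OF aV] by blast
  obtain x y where l: "leaf b x" "leaf c y"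
    using mate_of_hub_leaf[OF assms] m by metis
  have bc: "p b = p c" "p a = p b" using m(3,4) by simp_all
  note xy = leaf_mates[OF l bc(1) m(7) aV bc(2) m(5,6)]
  have px: "p x \<noteq> p a" using leafD[OF l(1)] m(3) by simp
  have lc: "leaf c x" using l(2) xy(1) by simp
  have pa: "part a = {a, b, c}"
  proof
    show "part a \<subseteq> {a, b, c}" using m(8) unfolding part_def by blast
    show "{a, b, c} \<subseteq> part a" using m(1-4) aV by (simp add: part_def)
  qed
  show ?thesis
    by (rule exI[of _ b], rule exI[of _ c], rule exI[of _ x], intro conjI)
      (fact m(3-7) pa l(1) lc xy(2) px aV)+
qed

text \<open>Three applications of \<open>hub_part\<close> yield the parts of hubs \<open>a\<close>,
  \<open>x\<close> and \<open>y\<close>, whose other vertices are leaves with hubs \<open>x\<close>,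
  \<open>y\<close> and \<open>z\<close>. There turn out to be no other parts, \<open>z\<close> is
  \<open>x\<close>, and \<open>a\<close> is a leaf too, which contradicts
  \<open>not_all_leaves\<close>.\<close>

lemma tight_False: False
proof -
  have "card B < card V" using card_B by simp
  then obtain u a where "leaf u a" using leaf_exists cover by blast
  from hub_part[OF this] obtain a' a'' x where A: "p a' = p a" "p a'' = p a" "a \<noteq> a'" "a \<noteq> a''" "a' \<noteq> a''"
    "part a = {a, a', a''}"
    "leaf a' x" "leaf a'' x" "\<not> adj x a" "p x \<noteq> p a" "a \<in> V"
    by (elim exE conjE) (rule that)
  have AP: "d = a \<or> d = a' \<or> d = a''" if "d \<in> V" "p d = p a" for d
    using A(6) that by (auto simp: part_def)
  from hub_part[OF A(7)] obtain x' x'' y where X: "p x' = p x" "p x'' = p x" "x \<noteq> x'" "x \<noteq> x''" "x' \<noteq> x''"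
    "part x = {x, x', x''}"
    "leaf x' y" "leaf x'' y" "\<not> adj y x" "p y \<noteq> p x" "x \<in> V"
    by (elim exE conjE) (rule that)
  have XP: "d = x \<or> d = x' \<or> d = x''" if "d \<in> V" "p d = p x" for d
    using X(6) that by (auto simp: part_def)
  \<comment> \<open>Such a \<open>v\<close> is not joined to \<open>x'\<close> or
    \<open>x''\<close>, whose only neighbour is \<open>y\<close>. So
    \<open>third_part_unique\<close> leaves it a single neighbour.\<close>
  have other: "\<exists>d. leaf v d" if v: "v \<in> V" "p v \<noteq> p a" "p v \<noteq> p x" "v \<noteq> y" for v
  proof -
    have *: "p d \<noteq> p x \<or> d = x" if "adj v d" for d
      using XP[of d] adjD[OF that] leaf_eq'[OF X(7), of v] leaf_eq'[OF X(8), of v] that v by metis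
    obtain d where d: "adj v d" using cover[OF v(1)] by blast
    have "leaf v d"
      unfolding leaf_def using third_part_unique[OF A(7) v(1), of d] d * v A(1) by metis
    then show ?thesis ..
  qed
  \<comment> \<open>Each part has a vertex that is no leaf; outside the parts of \<open>a\<close>
    and \<open>x\<close> this can only be \<open>y\<close>.\<close>
  have no_part: "p v = p a \<or> p v = p x \<or> p v = p y" if "v \<in> V" for v
    using not_all_leaves[OF that] other by metis
  have ya: "p y \<noteq> p a"
    using no_part third[OF A(11) X(11)] by metis
  from hub_part[OF X(7)] obtain y' y'' z where Y: "p y' = p y" "p y'' = p y" "y \<noteq> y'" "y \<noteq> y''" "y' \<noteq> y''"
    "part y = {y, y', y''}"
    "leaf y' z" "leaf y'' z" "\<not> adj z y" "p z \<noteq> p y"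
    by (elim exE conjE) (rule that)
  have YP: "d = y \<or> d = y' \<or> d = y''" if "d \<in> V" "p d = p y" for d
    using Y(6) that by (auto simp: part_def)
  \<comment> \<open>By \<open>third_part_neighbour\<close>, \<open>a\<close> is joined to
    \<open>y\<close>, \<open>x\<close> or \<open>x''\<close>. It is not joined to \<open>x\<close>,
    and \<open>x''\<close> has only the neighbour \<open>y\<close>.\<close>
  have "adj a y"
  proof -
    obtain d where d: "d = y \<or> p d = p x' \<and> d \<noteq> x'" "adj a d"
      using third_part_neighbour[OF X(7) A(11)] A(10) ya X(1) by metis
    then have "d = y \<or> d = x \<or> d = x''" using XP[of d] X(1) adjD by metis
    then show ?thesis
      using d(2) A(9) adj_sym leaf_eq'[OF X(8), of a] ya by metis
  qed
  \<comment> \<open>The neighbour \<open>z\<close> of \<open>y'\<close> is \<open>x\<close>,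
    \<open>a\<close> or \<open>a''\<close>. The leaf \<open>a''\<close> has only the neighbour
    \<open>x\<close>, and \<open>a\<close> is joined to \<open>y\<close> while \<open>z\<close> is
    not.\<close>
  have "z = x"
  proof -
    have "y' \<in> V" using leafD[OF Y(7)] by simp
    then obtain d where d: "d = x \<or> p d = p a' \<and> d \<noteq> a'" "adj y' d"
      using third_part_neighbour[OF A(7), of y'] Y(1) ya X(10) A(1) by metis
    then have "d = x \<or> d = a \<or> d = a''" using AP[of d] A(1) adjD by metis
    moreover have "d \<noteq> a''" using d(2) leaf_eq'[OF A(8), of y'] Y(1) X(10) by metis
    moreover have "d = z" using leaf_eq[OF Y(7) d(2)] .
    ultimately show ?thesis using Y(9) \<open>adj a y\<close> by metis
  qed
  have "leaf a y"
    unfolding leaf_def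
  proof (intro conjI allI impI)
    fix d assume d: "adj a d"
    then have "d \<in> V" "p d \<noteq> p a" using adjD by metis+
    then have "d \<in> {x, x', x'', y, y', y''}" using no_part XP YP by blast
    then show "d = y"
      using A(9) d adj_sym leaf_eq'[OF X(7), of a] leaf_eq'[OF X(8), of a] leaf_eq'[OF Y(7), of a]
        leaf_eq'[OF Y(8), of a] A(10) ya \<open>z = x\<close> by blast
  qed fact
  then show False using not_all_leaves[OF A(11)] AP A(7,8) by metis
qed

end

lemma (in critical) card_ge_minus_1:
  assumes "\<And>u. u \<in> V \<Longrightarrow> card (part u) = 3"
    and "\<And>u v. u \<in> V \<Longrightarrow> v \<in> V \<Longrightarrow> \<exists>w\<in>V. p w \<noteq> p u \<and> p w \<noteq> p v"
  shows "card V - 1 \<le> card B"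
proof (rule ccontr)
  assume less: "\<not> ?thesis"
  have cover: "\<exists>x. adj v x" if v: "v \<in> V" for v
  proof (rule ccontr)
    assume no: "\<not> (\<exists>x. adj v x)"
    \<comment> \<open>An uncovered \<open>v\<close> could take value 2 and its two mates value 1,
      for a total of 4.\<close>
    have "rdn_le V (E - B) 4"
    proof (rule rdn_leI[of "{v}" _ "part v - {v}"])
      fix w assume w: "w \<in> V" "w \<notin> {v}" "w \<notin> part v - {v}"
      then have "{w, v} \<in> E" using v by (auto simp: edge_iff part_def)
      moreover have "{w, v} \<notin> B" using no by (auto simp: adj_def insert_commute)
      ultimately show "\<exists>x\<in>{v}. {w, x} \<in> E - B" by simp
    next
      have "v \<in> part v" using v by (simp add: part_def)
      then show "2 * card {v} + card (part v - {v}) \<le> 4" using assms(1)[OF v] by simp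
    qed (use v in \<open>auto simp: part_def\<close>)
    then show False using crit by simp
  qed
  interpret tight V E p B
    by unfold_locales (use assms cover less in auto)
  show False by (rule tight_False)
qed

section \<open>Deletion sets attaining the bounds for parts of size at least three\<close>

context multipartite
begin

definition star :: "'a \<Rightarrow> 'a set set" where
  "star x = (\<lambda>v. {x, v}) ` (V - part x)"

lemma star_sub: "x \<in> V \<Longrightarrow> star x \<subseteq> E"
  by (auto simp: star_def part_def edge_iff)

lemma card_star_le: "card (star x) \<le> card V - card (part x)"
  unfolding star_def card_minus_part[symmetric] using finV by (intro card_image_le) simp

lemma not_edge_minus_star:
  assumes "star x \<subseteq> B"
  shows "{x, v} \<notin> E - B"
proof
  assume "{x, v} \<in> E - B"
  moreover from this have "{x, v} \<in> star x" by (auto simp: star_def part_def edge_iff)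
  ultimately show False using assms by blast
qed

lemma card_two_parts:
  assumes "p x \<noteq> p y"
  shows "card (part x) + card (part y) \<le> card V"
proof -
  have "card (part x) + card (part y) = card (part x \<union> part y)"
    using assms by (intro card_Un_disjoint[symmetric] finite_part) (auto simp: part_def)
  also have "\<dots> \<le> card V" using finV by (intro card_mono) (auto simp: part_def)
  finally show ?thesis .
qed

lemma not_rdn_le_3_parts_3:
  assumes "4 \<le> card V" "\<And>u. u \<in> V \<Longrightarrow> 3 \<le> card (part u)"
  shows "\<not> rdn_le V E 3"
  using not_rdn_le_3[of "{}"] assms by simp

lemma two_mates:
  assumes "3 \<le> card (part v)"
  obtains a b where "a \<in> V" "b \<in> V" "p a = p v" "p b = p v" "a \<noteq> b" "a \<noteq> v" "b \<noteq> v"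
  using other_mate2[OF assms, of v] other_mate2[OF assms] by metis

text \<open>Isolating \<open>x\<close> is enough here: its part keeps at least three other vertices,
  so every other vertex has two non-neighbours besides \<open>x\<close>.\<close>

lemma bondage_parts_ge_3:
  assumes part3: "\<And>u. u \<in> V \<Longrightarrow> 3 \<le> card (part u)"
    and part_le: "\<And>u. u \<in> V \<Longrightarrow> card (part u) \<le> card (part x)"
    and x: "x \<in> V" "4 \<le> card (part x)" and y: "y \<in> V" "p y \<noteq> p x"
  shows "roman_bondage_number V E = enat (card V - card (part x))"
proof (rule roman_bondage_number_eqI[where k = 3, OF simple _ _ star_sub[OF x(1)] card_star_le])
  have Suc: "Suc 3 = 4" by simp
  have V6: "6 \<le> card V" using card_two_parts[of x y] y part3[of y] x by simp
  show "rdn_le V E (Suc 3)" unfolding Suc using rdn_le_4[of x y] x y by simp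
  show "\<not> rdn_le V E 3" using not_rdn_le_3_parts_3 V6 part3 by simp
  show "\<not> rdn_le V (E - star x) (Suc 3)"
    unfolding Suc
  proof (rule not_rdn_le_4_isolated[OF V6 x(1) not_edge_minus_star[OF order_refl]])
    fix v assume v: "v \<in> V" "v \<noteq> x"
    have "\<exists>a\<in>V. \<exists>b\<in>V. a \<noteq> b \<and> a \<noteq> x \<and> b \<noteq> x \<and> a \<noteq> v \<and> b \<noteq> v \<and> p a = p v \<and> p b = p v"
    proof (cases "p v = p x")
      case True
      then have "4 \<le> card (part v)" using x(2) by (simp add: part_def)
      then show ?thesis using other_mate3[of v x x] other_mate3[of v x] by metis
    next
      case False
      then show ?thesis using two_mates[OF part3[OF v(1)]] by metis
    qed
    then show "\<exists>a\<in>V. \<exists>b\<in>V. a \<noteq> b \<and> a \<noteq> x \<and> b \<noteq> x \<and> a \<noteq> v \<and> b \<noteq> v \<and>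
        {v, a} \<notin> E - star x \<and> {v, b} \<notin> E - star x"
      by (metis DiffD1 edge_iff)
  qed
  fix B assume B: "B \<subseteq> E" "\<not> rdn_le V (E - B) (Suc 3)"
  interpret critical V E p B by unfold_locales (use B in \<open>auto simp: Suc\<close>)
  show "card V - card (part x) \<le> card B"
    by (rule card_ge_minus_part) (use part_le x in auto)
qed

text \<open>After isolating \<open>x\<close>, the other two vertices \<open>a\<close> and
  \<open>b\<close> of its part have only one non-neighbour each besides \<open>x\<close>. Deleting
  their edges to a common \<open>y\<close> supplies the second one.\<close>

lemma bondage_parts_eq_3:
  assumes part3: "\<And>u. u \<in> V \<Longrightarrow> card (part u) = 3"
    and third: "\<And>u v. u \<in> V \<Longrightarrow> v \<in> V \<Longrightarrow> \<exists>w\<in>V. p w \<noteq> p u \<and> p w \<noteq> p v"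
    and x: "x \<in> V"
  shows "roman_bondage_number V E = enat (card V - 1)"
proof -
  have Suc: "Suc 3 = 4" by simp
  have part3': "3 \<le> card (part u)" if "u \<in> V" for u using part3[OF that] by simp
  obtain y where y: "y \<in> V" "p y \<noteq> p x" using third[OF x x] by blast
  have V6: "6 \<le> card V" using card_two_parts[of x y] y part3[of y] part3[of x] x by simp
  obtain a b where ab: "a \<in> V" "b \<in> V" "p a = p x" "p b = p x" "a \<noteq> b" "a \<noteq> x" "b \<noteq> x"
    using two_mates[OF part3'[OF x]] by metis
  define B where "B = star x \<union> {{a, y}, {b, y}}"
  have BE: "B \<subseteq> E" using star_sub[OF x] ab y by (auto simp: B_def edge_iff)
  have part_x: "v = x \<or> v = a \<or> v = b" if "v \<in> V" "p v = p x" for v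
  proof -
    have "{x, a, b} = part x"
      using part3[OF x] ab x by (intro card_seteq) (auto simp: part_def finV)
    then show ?thesis using that by (auto simp: part_def)
  qed
  show ?thesis
  proof (rule roman_bondage_number_eqI[where k = 3, OF simple _ _ BE])
    have "card B \<le> card (star x) + card {{a, y}, {b, y}}" unfolding B_def by (rule card_Un_le)
    also have "\<dots> \<le> card V - 3 + 2"
      using card_star_le[of x] part3[OF x] by (intro add_mono) (auto simp: card_insert_if)
    finally show "card B \<le> card V - 1" using V6 by simp
    show "rdn_le V E (Suc 3)" unfolding Suc using rdn_le_4[of x y] x y by simp
    show "\<not> rdn_le V E 3" using not_rdn_le_3_parts_3 V6 part3' by simp
    show "\<not> rdn_le V (E - B) (Suc 3)"
      unfolding Suc
    proof (rule not_rdn_le_4_isolated[OF V6 x(1)])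
      show "{x, v} \<notin> E - B" for v by (rule not_edge_minus_star) (auto simp: B_def)
      fix v assume v: "v \<in> V" "v \<noteq> x"
      have "\<exists>c\<in>V. \<exists>d\<in>V. c \<noteq> d \<and> c \<noteq> x \<and> d \<noteq> x \<and> c \<noteq> v \<and> d \<noteq> v \<and> p c = p v \<and>
          (p d = p v \<or> {v, d} \<in> B)"
      proof (cases "p v = p x")
        case True
        have "y \<noteq> a" "y \<noteq> b" "y \<noteq> x" using y(2) ab by auto
        moreover have "{a, y} \<in> B" "{b, y} \<in> B" by (simp_all add: B_def)
        ultimately have "w \<noteq> x \<and> w \<noteq> v \<and> p w = p v \<and> {v, y} \<in> B \<and> y \<noteq> x \<and> y \<noteq> v \<and> w \<noteq> y"
          if "v = a \<and> w = b \<or> v = b \<and> w = a" for w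
          using that ab by auto
        then show ?thesis using part_x[OF v(1) True] v(2) ab(1,2) y(1) by blast
      next
        case False
        then show ?thesis using two_mates[OF part3'[OF v(1)]] by metis
      qed
      then show "\<exists>c\<in>V. \<exists>d\<in>V. c \<noteq> d \<and> c \<noteq> x \<and> d \<noteq> x \<and> c \<noteq> v \<and> d \<noteq> v \<and>
          {v, c} \<notin> E - B \<and> {v, d} \<notin> E - B"
        by (metis DiffD1 DiffD2 edge_iff)
    qed
    fix C assume C: "C \<subseteq> E" "\<not> rdn_le V (E - C) (Suc 3)"
    interpret critical V E p C by unfold_locales (use C in \<open>auto simp: Suc\<close>)
    show "card V - 1 \<le> card C" by (rule card_ge_minus_1[OF part3 third])
  qed
qed

end

section \<open>From the indexed family of parts to the five cases\<close>

lemma complete_multipartiteE: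
  assumes "simple_graph V E" "complete_multipartite V E t m"
  obtains p P where "multipartite V E p"
    and "\<And>j. j \<in> {1..t} \<Longrightarrow> P j = {v\<in>V. p v = j}"
    and "\<And>j. j \<in> {1..t} \<Longrightarrow> card (P j) = m j \<and> m j \<ge> 1"
    and "\<And>v. v \<in> V \<Longrightarrow> p v \<in> {1..t}"
proof -
  obtain P where P: "disjoint_family_on P {1..t}" "V = (\<Union>j\<in>{1..t}. P j)"
    "\<And>j. j \<in> {1..t} \<Longrightarrow> card (P j) = m j \<and> m j \<ge> 1"
    "E = {{u, v} | u v j k. j \<in> {1..t} \<and> k \<in> {1..t} \<and> j \<noteq> k \<and> u \<in> P j \<and> v \<in> P k}"
    using assms(2) unfolding complete_multipartite_def by blast
  obtain p where p: "\<And>v. v \<in> V \<Longrightarrow> p v \<in> {1..t} \<and> v \<in> P (p v)"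
    using P(2) by (metis UN_iff)
  have p_eq: "p v = j" if "j \<in> {1..t}" "v \<in> P j" for v j
  proof (rule ccontr)
    assume "p v \<noteq> j"
    moreover have "v \<in> V" using P(2) that by blast
    ultimately have "P (p v) \<inter> P j = {}" using P(1) p[of v] that by (auto simp: disjoint_family_on_def)
    then show False using p[OF \<open>v \<in> V\<close>] that by blast
  qed
  have edge: "{u, v} \<in> E \<longleftrightarrow> u \<in> V \<and> v \<in> V \<and> p u \<noteq> p v" for u v
  proof
    assume "{u, v} \<in> E"
    then obtain u' v' j k where *: "{u, v} = {u', v'}" "j \<in> {1..t}" "k \<in> {1..t}" "j \<noteq> k"
      "u' \<in> P j" "v' \<in> P k"
      unfolding P(4) by blast
    then have "u' \<in> V" "v' \<in> V" "p u' \<noteq> p v'" using P(2) p_eq by blast+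
    then show "u \<in> V \<and> v \<in> V \<and> p u \<noteq> p v" using *(1) by (auto simp: doubleton_eq_iff)
  next
    assume "u \<in> V \<and> v \<in> V \<and> p u \<noteq> p v"
    then show "{u, v} \<in> E" unfolding P(4) using p by blast
  qed
  show thesis
  proof (rule that)
    show "multipartite V E p"
      by unfold_locales (use assms(1) edge in \<open>auto simp: simple_graph_def\<close>)
    show "P j = {v\<in>V. p v = j}" if "j \<in> {1..t}" for j
      using p p_eq P(2) that by blast
  qed (use P(3) p in auto)
qed

theorem theorem3p1:
  fixes V :: "'a set" and E :: "'a set set" and t i n :: nat and m :: "nat \<Rightarrow> nat"
  assumes "t \<ge> 2"
    and "simple_graph V E"
    and "complete_multipartite V E t m"
    and "1 \<le> i" and "i \<le> t"
    and "\<forall>j\<in>{1..i}. m j = m 1"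
    and "i < t \<longrightarrow> m i < m (i + 1)"
    and "\<forall>j\<in>{i + 1..<t}. m j \<le> m (j + 1)"
    and "n = (\<Sum>j=1..t. m j)"
  shows "(m i = 1 \<and> n \<ge> 3 \<longrightarrow> roman_bondage_number V E = enat (nat \<lceil>real i / 2\<rceil>)) \<and>
         (m i = 2 \<and> i = 1 \<longrightarrow> roman_bondage_number V E = enat 2) \<and>
         (m i = 2 \<and> i \<ge> 2 \<longrightarrow> roman_bondage_number V E = enat i) \<and>
         (m i = 3 \<and> i = t \<and> t \<ge> 3 \<longrightarrow> roman_bondage_number V E = enat (n - 1)) \<and>
         (m i \<ge> 3 \<and> m t \<ge> 4 \<longrightarrow> roman_bondage_number V E = enat (n - m t))"
proof -
  obtain p P where mp: "multipartite V E p"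
    and P: "\<And>j. j \<in> {1..t} \<Longrightarrow> P j = {v\<in>V. p v = j}"
      "\<And>j. j \<in> {1..t} \<Longrightarrow> card (P j) = m j \<and> m j \<ge> 1"
    and pV: "\<And>v. v \<in> V \<Longrightarrow> p v \<in> {1..t}"
    by (rule complete_multipartiteE[OF assms(2,3)]) (rule that)
  interpret multipartite V E p by (rule mp)
  have part: "part v = P (p v)" if "v \<in> V" for v
    using P(1)[OF pV[OF that]] by (auto simp: part_def)
  have card_part: "card (part v) = m (p v)" if "v \<in> V" for v
    using part[OF that] P(2)[OF pV[OF that]] by simp
  have ex: "\<exists>v\<in>V. p v = j" if "j \<in> {1..t}" for j
    using P(1)[OF that] P(2)[OF that] by (cases "P j = {}") auto
  have mono: "m j \<le> m k" if "i + 1 \<le> j" "j \<le> k" "k \<le> t" for j k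
    using that(2,3)
  proof (induction k rule: dec_induct)
    case (step k)
    then have "m k \<le> m (k + 1)" using bspec[OF assms(8), of k] that(1) by simp
    then show ?case using step by simp
  qed simp
  have min: "m j = m i" if "j \<in> {1..i}" for j
    using bspec[OF assms(6), of j] bspec[OF assms(6), of i] assms(4) that by simp
  have above: "m i < m j" if "j \<in> {1..t}" "\<not> j \<le> i" for j
    using mono[of "i + 1" j] assms(7) that by auto
  have m_ge: "m i \<le> m j" if "j \<in> {1..t}" for j
    using min[of j] above[of j] that by (cases "j \<le> i") auto
  have m_le: "m j \<le> m t" if "j \<in> {1..t}" for j
    using min[of j] m_ge[of t] mono[of j t] assms(1) that by (cases "j \<le> i") auto
  \<comment> \<open>Used for all indices, where the sum is \<open>n\<close>, and for the indices up
    to \<open>i\<close>, which count the vertices in parts of minimum size.\<close>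
  have card_low: "card {v\<in>V. p v \<in> J} = (\<Sum>j\<in>J. m j)" if "J \<subseteq> {1..t}" for J
  proof -
    have PJ: "P j = {v\<in>V. p v = j}" if "j \<in> J" for j
      using P(1)[of j] that \<open>J \<subseteq> {1..t}\<close> by blast
    have "{v\<in>V. p v \<in> J} = (\<Union>j\<in>J. P j)" using PJ by auto
    also have "card \<dots> = (\<Sum>j\<in>J. card (P j))"
    proof (rule card_UN_disjoint)
      show "finite J" using that finite_subset by blast
      show "\<forall>j\<in>J. finite (P j)" using PJ finV by auto
      show "\<forall>j\<in>J. \<forall>k\<in>J. j \<noteq> k \<longrightarrow> P j \<inter> P k = {}" using PJ by auto
    qed
    also have "\<dots> = (\<Sum>j\<in>J. m j)" using P(2) that by (intro sum.cong) auto
    finally show ?thesis .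
  qed
  have n: "card V = n"
  proof -
    have "{v\<in>V. p v \<in> {1..t}} = V" using pV by auto
    then show ?thesis using card_low[of "{1..t}"] assms(9) by simp
  qed
  have low_iff: "card (part v) = m i \<longleftrightarrow> p v \<in> {1..i}" if "v \<in> V" for v
    using card_part[OF that] min[of "p v"] above[of "p v"] pV[OF that] by force
  then have low: "{v\<in>V. card (part v) = m i} = {v\<in>V. p v \<in> {1..i}}" by blast
  have card_lowi: "card {v\<in>V. card (part v) = m i} = i * m i"
  proof -
    have "(\<Sum>j\<in>{1..i}. m j) = (\<Sum>j\<in>{1..i}. m i)" by (rule sum.cong[OF refl min])
    then show ?thesis using card_low[of "{1..i}"] assms(5) unfolding low by simp
  qed
  obtain x\<^sub>1 x\<^sub>2 x\<^sub>t where xs: "x\<^sub>1 \<in> V" "p x\<^sub>1 = 1" "x\<^sub>2 \<in> V" "p x\<^sub>2 = 2" "x\<^sub>t \<in> V" "p x\<^sub>t = t"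
    using ex[of 1] ex[of 2] ex[of t] assms(1) by auto
  have part_ge: "m i \<le> card (part v)" if "v \<in> V" for v
    using card_part[OF that] m_ge[OF pV[OF that]] by simp
  have V4: "4 \<le> card V" if "2 \<le> m i"
    using card_two_parts[of x\<^sub>1 x\<^sub>2] xs part_ge[of x\<^sub>1] part_ge[of x\<^sub>2] that by simp
  show ?thesis
  proof (intro conjI impI)
    assume *: "m i = 1 \<and> n \<ge> 3"
    then have c: "card {v\<in>V. card (part v) = 1} = i" using card_lowi by simp
    then have "{v\<in>V. card (part v) = 1} \<noteq> {}" using assms(4) by (metis card.empty not_one_le_zero)
    then have "roman_bondage_number V E = enat ((i + 1) div 2)"
      using bondage_min_part_1 * n c by simp
    moreover have "nat \<lceil>real i / 2\<rceil> = (i + 1) div 2"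
    proof (cases "even i")
      case True
      then show ?thesis by (auto elim!: evenE)
    next
      case False
      then obtain k where k: "i = 2 * k + 1" by (auto elim: oddE)
      have "\<lceil>real i / 2\<rceil> = int k + 1" unfolding k by (intro ceiling_unique) auto
      then show ?thesis using k by simp
    qed
    ultimately show "roman_bondage_number V E = enat (nat \<lceil>real i / 2\<rceil>)" by simp
  next
    assume *: "m i = 2 \<and> i = 1"
    then have mi: "m i = 2" by blast
    have two: "card (part v) = 2 \<longleftrightarrow> p v = 1" if "v \<in> V" for v
      using low_iff[OF that] conjunct2[OF *] unfolding mi by auto
    obtain u where u: "u \<in> V" "p u = 1" "u \<noteq> x\<^sub>1"
      using other_mate[of x\<^sub>1] two[of x\<^sub>1] xs by auto
    have P1: "v = u \<or> v = x\<^sub>1" if "v \<in> V" "p v = 1" for v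
    proof -
      have "{u, x\<^sub>1} = part x\<^sub>1"
        using two[of x\<^sub>1] u xs by (intro card_seteq) (auto simp: part_def finV)
      then show ?thesis using that xs by (auto simp: part_def)
    qed
    show "roman_bondage_number V E = enat 2"
    proof (rule bondage_min_part_2)
      show "4 \<le> card V" using V4 mi by simp
      show "2 \<le> card (part v)" if "v \<in> V" for v using part_ge[OF that] mi by simp
      show "\<exists>v\<in>V. card (part v) = 2" using two xs by blast
      show "{{u, x\<^sub>2}, {x\<^sub>1, x\<^sub>2}} \<subseteq> E" using u xs by (auto simp: edge_iff)
      show "card {{u, x\<^sub>2}, {x\<^sub>1, x\<^sub>2}} \<le> 2" by (simp add: card_insert_if)
      show "\<exists>w. {v, w} \<in> {{u, x\<^sub>2}, {x\<^sub>1, x\<^sub>2}}" if "v \<in> V" "card (part v) = 2" for v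
        using P1[of v] two[of v] that by auto
      fix C assume C: "C \<subseteq> E" "\<And>v. v \<in> V \<Longrightarrow> card (part v) = 2 \<Longrightarrow> \<exists>w. {v, w} \<in> C"
      obtain w w' where w: "{u, w} \<in> C" "{x\<^sub>1, w'} \<in> C"
        using C(2)[of u] C(2)[of x\<^sub>1] two u xs by auto
      \<comment> \<open>The two vertices to be covered lie in the same part, so no single edge
        covers both.\<close>
      have "{u, x\<^sub>1} \<notin> E" using u xs by (simp add: edge_iff)
      then have "{u, w} \<noteq> {x\<^sub>1, w'}" using w C(1) u(3) by (auto simp: doubleton_eq_iff)
      then have "2 = card {{u, w}, {x\<^sub>1, w'}}" by simp
      also have "\<dots> \<le> card C" using w C(1) finE finite_subset by (intro card_mono) auto
      finally show "2 \<le> card C" .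
    qed
  next
    assume *: "m i = 2 \<and> i \<ge> 2"
    then have mi: "m i = 2" by blast
    have two: "card (part v) = 2 \<longleftrightarrow> p v \<in> {1..i}" if "v \<in> V" for v
      using low_iff[OF that] * by auto
    have "\<exists>a b. P j = {a, b}" if "j \<in> {1..i}" for j
      using P(2)[of j] min[OF that] that assms(5) * by (auto simp: card_2_iff)
    then obtain a b where ab: "\<And>j. j \<in> {1..i} \<Longrightarrow> P j = {a j, b j}" by metis
    have abV: "a j \<in> V" "p (a j) = j" "b j \<in> V" "p (b j) = j" if "j \<in> {1..i}" for j
      using ab[OF that] P(1)[of j] that assms(5) by auto
    \<comment> \<open>The cyclic successor on the parts of size 2. Joining \<open>a j\<close> to
      \<open>b (s j)\<close> covers all these parts with \<open>i\<close> edges, and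
      \<open>i \<ge> 2\<close> ensures that the ends lie in different parts.\<close>
    define s where "s j = (if j = i then 1 else j + 1)" for j
    define B where "B = (\<lambda>j. {a j, b (s j)}) ` {1..i}"
    have s: "s j \<in> {1..i}" "s j \<noteq> j" if "j \<in> {1..i}" for j
      using that * by (auto simp: s_def)
    show "roman_bondage_number V E = enat i"
    proof (rule bondage_min_part_2)
      show "4 \<le> card V" using V4 mi by simp
      show "2 \<le> card (part v)" if "v \<in> V" for v using part_ge[OF that] mi by simp
      show "\<exists>v\<in>V. card (part v) = 2" using two[of x\<^sub>1] xs * by auto
      have "{a j, b (s j)} \<in> E" if "j \<in> {1..i}" for j
        using abV[OF that] abV[OF s(1)[OF that]] s(2)[OF that] by (simp add: edge_iff)
      then show "B \<subseteq> E" by (auto simp: B_def)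
      show "card B \<le> i" unfolding B_def by (rule order_trans[OF card_image_le]) auto
      show "\<exists>w. {v, w} \<in> B" if v: "v \<in> V" "card (part v) = 2" for v
      proof -
        have j: "p v \<in> {1..i}" using two v by blast
        then have "v \<in> P (p v)" using P(1)[of "p v"] v assms(5) by auto
        then consider "v = a (p v)" | "v = b (p v)" using ab[OF j] by auto
        then show ?thesis
        proof cases
          case 1
          then have "{v, b (s (p v))} \<in> B" using j by (auto simp: B_def)
          then show ?thesis by blast
        next
          case 2
          \<comment> \<open>The cyclic predecessor of \<open>p v\<close>, whose edge covers the
            second vertex of the part.\<close>
          define k where "k = (if p v = 1 then i else p v - 1)"
          have k: "k \<in> {1..i}" "s k = p v" using j * by (auto simp: k_def s_def)
          then have "{a k, v} \<in> B" using 2 by (auto simp: B_def)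
          then show ?thesis by (metis insert_commute)
        qed
      qed
      fix C assume C: "C \<subseteq> E" "\<And>v. v \<in> V \<Longrightarrow> card (part v) = 2 \<Longrightarrow> \<exists>w. {v, w} \<in> C"
      have "card {v\<in>V. card (part v) = 2} \<le> 2 * card C"
        by (rule card_cover_le[OF C(1)]) (use C(2) in auto)
      then show "i \<le> card C" using card_lowi * by simp
    qed
  next
    assume *: "m i = 3 \<and> i = t \<and> t \<ge> 3"
    have "card (part v) = 3" if "v \<in> V" for v
      using card_part[OF that] min[of "p v"] pV[OF that] * by metis
    moreover have "\<exists>w\<in>V. p w \<noteq> p u \<and> p w \<noteq> p v" if "u \<in> V" "v \<in> V" for u v
    proof -
      obtain k where "k \<in> {1..t}" "k \<noteq> p u" "k \<noteq> p v"
      proof -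
        have "1 \<in> {1..t}" "2 \<in> {1..t}" "3 \<in> {1..t}" using * by auto
        moreover have "(1::nat) \<noteq> 2" "(2::nat) \<noteq> 3" "(1::nat) \<noteq> 3" by auto
        ultimately show ?thesis using that by metis
      qed
      then show ?thesis using ex[of k] by auto
    qed
    ultimately show "roman_bondage_number V E = enat (n - 1)"
      using bondage_parts_eq_3[OF _ _ xs(1)] n by blast
  next
    assume *: "m i \<ge> 3 \<and> m t \<ge> 4"
    have t: "card (part x\<^sub>t) = m t" using card_part xs by simp
    obtain y where y: "y \<in> V" "p y \<noteq> p x\<^sub>t"
      using xs assms(1) that[of x\<^sub>1] by auto
    have "roman_bondage_number V E = enat (card V - card (part x\<^sub>t))"
    proof (rule bondage_parts_ge_3[OF _ _ xs(5) _ y])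
      show "3 \<le> card (part v)" if "v \<in> V" for v using part_ge[OF that] * by simp
      show "card (part v) \<le> card (part x\<^sub>t)" if "v \<in> V" for v
        using card_part[OF that] m_le[OF pV[OF that]] t by simp
      show "4 \<le> card (part x\<^sub>t)" using t * by simp
    qed
    then show "roman_bondage_number V E = enat (n - m t)" using n t by simp
  qed
qed

end
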